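(* Let $\mathcal{C}$ be a sum closed, rc-invariant permutation class, and let $c_n$ be the number of sum-indecomposable permutations of size $n$ in $\mathcal{C}$. Consider the statements: (i) the sequence $(c_n)$ is bounded; (ii) $\lim_{n\to\infty}c_n^{1/n}$ exists and equals $0$ or $1$; (iii) $\lim_{n\to\infty}|\mathcal{C}^{rc}_{2n}|^{1/n}$ exists and equals $\lim_{n\to\infty}|\mathcal{C}_n|^{1/n}$. Then (i) implies (ii), and (ii) implies (iii).
   Context: A permutation of size $n$ is a bijection of $[n]$; a permutation class is a set of permutations closed downward under pattern containment; $\mathcal{C}_n$ is its set of size-$n$ elements. For $\pi$ of size $n$, $\mathrm{rc}(\pi)(i)=n+1-\pi(n+1-i)$; $\pi$ is centrosymmetric if $\mathrm{rc}(\pi)=\pi$; $\mathcal{C}^{rc}_n$ is the set of centrosymmetric elements of $\mathcal{C}_n$; $\mathcal{C}$ is rc-invariant if $\mathrm{rc}(\mathcal{C})=\mathcal{C}$. The sum $\sigma\oplus\tau$ of $\sigma$ (size $a$) and $\tau$ (size $b$) is given by $(\sigma\oplus\tau)(i)=\sigma(i)$ for $i\le a$ and $a+\tau(i-a)$ for $i>a$; $\mathcal{C}$ is sum closed if it is closed under $\oplus$ (then $\lim_n|\mathcal{C}_n|^{1/n}$ exists). A permutation is sum-indecomposable if it is not $\sigma\oplus\tau$ with $\sigma,\tau$ of nonzero size. *)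

theory Defs
  imports Complex_Main "HOL-Combinatorics.Permutations"
begin

text \<open>
  A permutation of size \<open>n\<close> is a pair \<open>(n, \<pi>)\<close> where \<open>\<pi>\<close> permutes \<open>{1..n}\<close>. The size has to be
  recorded because \<open>permutes\<close> extends \<open>\<pi>\<close> by the identity outside \<open>{1..n}\<close>, so the function alone
  does not determine it. The permutation of size \<open>0\<close> is included.
\<close>

type_synonym sized_perm = "nat \<times> (nat \<Rightarrow> nat)"

abbreviation psize :: "sized_perm \<Rightarrow> nat" where
  "psize p \<equiv> fst p"

definition is_perm :: "sized_perm \<Rightarrow> bool" where
  "is_perm p \<longleftrightarrow> snd p permutes {1..psize p}"

definition pattern_of :: "sized_perm \<Rightarrow> sized_perm \<Rightarrow> bool" where
  "pattern_of q p \<longleftrightarrow>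
     (\<exists>f. f ` {1..psize q} \<subseteq> {1..psize p} \<and> strict_mono_on {1..psize q} f \<and>
        (\<forall>i\<in>{1..psize q}. \<forall>j\<in>{1..psize q}.
           snd q i < snd q j \<longleftrightarrow> snd p (f i) < snd p (f j)))"

definition perm_class :: "sized_perm set \<Rightarrow> bool" where
  "perm_class C \<longleftrightarrow>
     (\<forall>p\<in>C. is_perm p) \<and> (\<forall>p\<in>C. \<forall>q. is_perm q \<and> pattern_of q p \<longrightarrow> q \<in> C)"

definition of_size :: "sized_perm set \<Rightarrow> nat \<Rightarrow> sized_perm set" where
  "of_size C n = {p \<in> C. psize p = n}"

definition rc :: "sized_perm \<Rightarrow> sized_perm" where
  "rc p = (psize p,
     \<lambda>i. if i \<in> {1..psize p} then psize p + 1 - snd p (psize p + 1 - i) else i)"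

definition centrosymmetric :: "sized_perm \<Rightarrow> bool" where
  "centrosymmetric p \<longleftrightarrow> rc p = p"

definition rc_invariant :: "sized_perm set \<Rightarrow> bool" where
  "rc_invariant C \<longleftrightarrow> rc ` C = C"

text \<open>
  The formula needs no guard: if \<open>\<sigma>\<close> and \<open>\<tau>\<close> are the identity outside \<open>{1..a}\<close> and \<open>{1..b}\<close>, the
  result is the identity outside \<open>{1..a + b}\<close>.
\<close>

definition perm_sum :: "sized_perm \<Rightarrow> sized_perm \<Rightarrow> sized_perm" where
  "perm_sum s t = (psize s + psize t,
     \<lambda>i. if i \<le> psize s then snd s i else psize s + snd t (i - psize s))"

definition sum_closed :: "sized_perm set \<Rightarrow> bool" where
  "sum_closed C \<longleftrightarrow> (\<forall>s\<in>C. \<forall>t\<in>C. perm_sum s t \<in> C)"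

definition sum_indecomposable :: "sized_perm \<Rightarrow> bool" where
  "sum_indecomposable p \<longleftrightarrow>
     \<not> (\<exists>s t. is_perm s \<and> is_perm t \<and> psize s \<noteq> 0 \<and> psize t \<noteq> 0 \<and> p = perm_sum s t)"

end

theory Submission
  imports Defs
begin

text \<open>
  Call \<open>k\<close> a cut of a permutation if it preserves \<open>{1..k}\<close>; sum-indecomposable means that there is
  no proper cut. Indecomposability is connectedness of the inversion graph, so growing a connected
  vertex set one vertex at a time shows that an indecomposable permutation contains indecomposable
  patterns of all smaller positive sizes; hence \<open>c\<close> is eventually zero or always positive, which
  gives the first implication. For the second one, let \<open>a n\<close> count \<open>C\<close> and \<open>b n\<close> count the
  centrosymmetric elements of size \<open>2 n\<close>. Splitting at the first cut bounds \<open>a\<close> by a geometric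
  sequence, so that Fekete's lemma gives \<open>a n \<le> L ^ n\<close> with \<open>L\<close> the growth rate. A centrosymmetric
  permutation is \<open>\<sigma> \<oplus> \<mu> \<oplus> rc \<sigma>\<close> with \<open>\<mu>\<close> indecomposable, so
  \<open>a n \<le> b n \<le> (\<Sum>j\<le>n. a (n - j) * c (2 * j))\<close>, and the subexponential factor \<open>c\<close> is harmless.
\<close>

section \<open>Cuts and blocks\<close>

text \<open>A permutation fixes \<open>0\<close>, so position \<open>0\<close> may be included; no
  lower bound on the values is then needed.\<close>

definition cut :: "sized_perm \<Rightarrow> nat \<Rightarrow> bool" where
  "cut p k \<longleftrightarrow> (\<forall>i\<le>k. snd p i \<le> k)"

text \<open>When \<open>a\<close> and \<open>a + m\<close> are cuts, all values involved exceed
  \<open>a\<close>, so the truncated subtraction is exact and the shift standardizes. Being the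
  identity elsewhere is what \<open>is_perm\<close> demands.\<close>

definition block :: "sized_perm \<Rightarrow> nat \<Rightarrow> nat \<Rightarrow> sized_perm" where
  "block p a m = (m, \<lambda>i. if i \<in> {1..m} then snd p (i + a) - a else i)"

lemma psize_block [simp]: "psize (block p a m) = m"
  by (simp add: block_def)

lemma is_perm_inj: "is_perm p \<Longrightarrow> snd p i = snd p j \<longleftrightarrow> i = j"
  unfolding is_perm_def by (meson injD permutes_inj)

lemma is_perm_outside: "is_perm p \<Longrightarrow> i = 0 \<or> psize p < i \<Longrightarrow> snd p i = i"
  unfolding is_perm_def by (rule permutes_not_in) auto

lemma is_perm_0 [simp]: "is_perm p \<Longrightarrow> snd p 0 = 0"
  by (simp add: is_perm_outside)

lemma is_perm_inside:
  assumes "is_perm p" "1 \<le> i" "i \<le> psize p"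
  shows "1 \<le> snd p i" "snd p i \<le> psize p"
proof -
  have "snd p i \<in> {1..psize p}"
    using assms permutes_in_image[of "snd p" "{1..psize p}" i] by (auto simp: is_perm_def)
  then show "1 \<le> snd p i" "snd p i \<le> psize p" by auto
qed

lemma is_permI:
  assumes "\<And>i. 1 \<le> i \<Longrightarrow> i \<le> psize p \<Longrightarrow> 1 \<le> snd p i \<and> snd p i \<le> psize p"
    and "\<And>i j. 1 \<le> i \<Longrightarrow> i < j \<Longrightarrow> j \<le> psize p \<Longrightarrow> snd p i \<noteq> snd p j"
    and "\<And>i. i = 0 \<or> psize p < i \<Longrightarrow> snd p i = i"
  shows "is_perm p"
proof -
  have inj: "inj_on (snd p) {1..psize p}"
    by (rule linorder_inj_onI) (use assms(2) in auto)
  have "snd p ` {1..psize p} = {1..psize p}"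
    by (rule endo_inj_surj) (use inj assms(1) in auto)
  then have "bij_betw (snd p) {1..psize p} {1..psize p}"
    using inj by (simp add: bij_betw_def)
  then show ?thesis
    unfolding is_perm_def by (rule bij_imp_permutes) (use assms(3) in auto)
qed

lemma cut_0 [simp]: "is_perm p \<Longrightarrow> cut p 0"
  by (simp add: cut_def)

lemma cut_psize [simp]: "is_perm p \<Longrightarrow> cut p (psize p)"
  unfolding cut_def by (metis is_perm_0 is_perm_inside(2) le0 less_one not_less)

text \<open>An injective self-map of the finite set \<open>{..k}\<close> is onto, so the values up
  to \<open>k\<close> are used up by the positions up to \<open>k\<close>.\<close>

lemma cut_gt:
  assumes "is_perm p" "cut p k" "k < i"
  shows "k < snd p i"
proof (rule ccontr)
  assume "\<not> k < snd p i"
  moreover have "snd p ` {..k} = {..k}"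
    by (rule endo_inj_surj) (use assms in \<open>auto simp: cut_def inj_on_def is_perm_inj\<close>)
  ultimately obtain j where "j \<le> k" "snd p i = snd p j"
    by (metis atMost_iff imageE not_less)
  with assms show False by (simp add: is_perm_inj)
qed

lemma is_perm_block:
  assumes "is_perm p" "cut p a" "cut p (a + m)"
  shows "is_perm (block p a m)"
proof (rule is_permI)
  fix i assume i: "1 \<le> i" "i \<le> psize (block p a m)"
  have "a < snd p (i + a)" using assms i by (intro cut_gt) auto
  moreover have "snd p (i + a) \<le> a + m" using assms(3) i by (auto simp: cut_def)
  ultimately show "1 \<le> snd (block p a m) i \<and> snd (block p a m) i \<le> psize (block p a m)"
    using i by (auto simp: block_def)
next
  fix i j assume ij: "1 \<le> i" "i < j" "j \<le> psize (block p a m)"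
  have "a < snd p (i + a)" "a < snd p (j + a)" using assms ij by (auto intro: cut_gt)
  moreover have "snd p (i + a) \<noteq> snd p (j + a)" using assms ij by (simp add: is_perm_inj)
  ultimately show "snd (block p a m) i \<noteq> snd (block p a m) j"
    using ij by (auto simp: block_def)
qed (auto simp: block_def)

lemma pattern_of_block:
  assumes "is_perm p" "cut p a" "a + m \<le> psize p"
  shows "pattern_of (block p a m) p"
  unfolding pattern_of_def
proof (intro exI[of _ "\<lambda>i. i + a"] conjI ballI)
  fix i j assume "i \<in> {1..psize (block p a m)}" "j \<in> {1..psize (block p a m)}"
  moreover from this have "a < snd p (i + a)" "a < snd p (j + a)"
    using assms by (auto intro: cut_gt)
  ultimately show "snd (block p a m) i < snd (block p a m) j \<longleftrightarrow> snd p (i + a) < snd p (j + a)"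
    by (auto simp: block_def)
qed (use assms in \<open>auto simp: strict_mono_on_def\<close>)

lemma snd_eq_block:
  assumes "is_perm p" "cut p a" "a < i" "i \<le> a + m"
  shows "snd p i = a + snd (block p a m) (i - a)"
  using cut_gt[OF assms(1-3)] assms(3,4) by (auto simp: block_def)

text \<open>This turns a proper cut into a decomposition, and it also shows that the two blocks
  determine \<open>p\<close>, which gives injectivity in
  \<open>card_of_size_le_convolution\<close>.\<close>

lemma perm_sum_blocks:
  assumes "is_perm p" "cut p k" "k \<le> psize p"
  shows "p = perm_sum (block p 0 k) (block p k (psize p - k))"
proof (rule prod_eqI)
  show "snd p = snd (perm_sum (block p 0 k) (block p k (psize p - k)))"
  proof
    fix i
    consider "i = 0" | "1 \<le> i" "i \<le> k" | "k < i" "i \<le> psize p" | "psize p < i" by linarith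
    then show "snd p i = snd (perm_sum (block p 0 k) (block p k (psize p - k))) i"
    proof cases
      case 3
      with assms show ?thesis
        using snd_eq_block[of p k i "psize p - k"] by (simp add: perm_sum_def)
    next
      case 4
      with assms have "snd p i = i" by (simp add: is_perm_outside)
      with 4 assms show ?thesis by (simp add: perm_sum_def block_def)
    qed (use assms in \<open>auto simp: perm_sum_def block_def\<close>)
  qed
qed (use assms in \<open>simp add: perm_sum_def\<close>)

text \<open>Size \<open>0\<close> counts as indecomposable on both sides; the empty middle block of
  a centrosymmetric permutation relies on this.\<close>

lemma sum_indecomposable_iff_cut:
  assumes "is_perm p"
  shows "sum_indecomposable p \<longleftrightarrow> (\<forall>k. 0 < k \<longrightarrow> k < psize p \<longrightarrow> \<not> cut p k)"
proof
  assume ind: "sum_indecomposable p"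
  show "\<forall>k. 0 < k \<longrightarrow> k < psize p \<longrightarrow> \<not> cut p k"
  proof (intro allI impI notI)
    fix k assume k: "0 < k" "k < psize p" "cut p k"
    have "is_perm (block p 0 k)" "is_perm (block p k (psize p - k))"
      using assms k by (auto intro!: is_perm_block)
    moreover have "p = perm_sum (block p 0 k) (block p k (psize p - k))"
      using assms k by (intro perm_sum_blocks) auto
    ultimately show False
      using ind k unfolding sum_indecomposable_def by (metis neq0_conv psize_block zero_less_diff)
  qed
next
  assume nocut: "\<forall>k. 0 < k \<longrightarrow> k < psize p \<longrightarrow> \<not> cut p k"
  show "sum_indecomposable p"
    unfolding sum_indecomposable_def
  proof clarify
    fix s t
    assume st: "is_perm s" "is_perm t" "0 < psize s" "0 < psize t" and p: "p = perm_sum s t"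
    have "cut p (psize s)"
      using cut_psize[OF st(1)] unfolding p cut_def by (simp add: perm_sum_def)
    moreover have "psize s < psize p" using st by (simp add: p perm_sum_def)
    ultimately show False using nocut st by blast
  qed
qed

lemma psize_perm_sum [simp]: "psize (perm_sum s t) = psize s + psize t"
  by (simp add: perm_sum_def)

text \<open>Equal first sizes fix the place of the split. Without them a sum of identities could be
  split in several ways.\<close>

lemma perm_sum_inject:
  assumes "psize s = psize s'" "is_perm s" "is_perm s'" "is_perm t" "is_perm t'"
    and eq: "perm_sum s t = perm_sum s' t'"
  shows "s = s' \<and> t = t'"
proof -
  have sz: "psize t = psize t'" using arg_cong[OF eq, of psize] assms(1) by simp
  have eq': "snd (perm_sum s t) i = snd (perm_sum s' t') i" for i by (simp add: eq)
  have "snd s i = snd s' i" for i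
  proof (cases "i \<le> psize s")
    case True then show ?thesis using eq'[of i] assms(1) by (simp add: perm_sum_def)
  next
    case False then show ?thesis using assms by (simp add: is_perm_outside)
  qed
  moreover have "snd t i = snd t' i" for i
  proof (cases "i = 0")
    case False then show ?thesis using eq'[of "i + psize s"] assms(1) by (simp add: perm_sum_def)
  qed (use assms in simp)
  ultimately show ?thesis using sz assms(1) by (auto intro!: prod_eqI)
qed

section \<open>Reverse-complement\<close>

lemma psize_rc [simp]: "psize (rc p) = psize p"
  by (simp add: rc_def)

lemma is_perm_rc:
  assumes "is_perm p"
  shows "is_perm (rc p)"
proof (rule is_permI)
  fix i assume i: "1 \<le> i" "i \<le> psize (rc p)"
  then have "1 \<le> psize p + 1 - i" "psize p + 1 - i \<le> psize p" by auto
  from is_perm_inside[OF assms this] i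
  show "1 \<le> snd (rc p) i \<and> snd (rc p) i \<le> psize (rc p)" by (auto simp: rc_def)
next
  fix i j assume ij: "1 \<le> i" "i < j" "j \<le> psize (rc p)"
  have "snd p (psize p + 1 - i) \<noteq> snd p (psize p + 1 - j)"
    using ij by (subst is_perm_inj[OF assms]) auto
  moreover have "snd p (psize p + 1 - i) \<le> psize p" "snd p (psize p + 1 - j) \<le> psize p"
    using ij by (auto intro!: is_perm_inside(2)[OF assms])
  ultimately show "snd (rc p) i \<noteq> snd (rc p) j"
    using ij by (auto simp: rc_def)
qed (auto simp: rc_def)

lemma snd_rc: "1 \<le> i \<Longrightarrow> i \<le> psize p \<Longrightarrow> snd (rc p) i = psize p + 1 - snd p (psize p + 1 - i)"
  by (simp add: rc_def)

lemma centrosymmetric_snd: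
  assumes "centrosymmetric p" "1 \<le> i" "i \<le> psize p"
  shows "snd p i = psize p + 1 - snd p (psize p + 1 - i)"
  using snd_rc[OF assms(2,3)] assms(1) by (simp add: centrosymmetric_def)

text \<open>The positions above \<open>k\<close> carry values above \<open>k\<close>; the half-turn
  moves them to the first \<open>psize p - k\<close> positions and values.\<close>

lemma centrosymmetric_cut:
  assumes "is_perm p" "centrosymmetric p" "cut p k" "k \<le> psize p"
  shows "cut p (psize p - k)"
  unfolding cut_def
proof (intro allI impI)
  fix i assume i: "i \<le> psize p - k"
  show "snd p i \<le> psize p - k"
  proof (cases "i = 0")
    case False
    have "k < snd p (psize p + 1 - i)"
      using assms i False by (intro cut_gt) auto
    then show ?thesis
      using centrosymmetric_snd[OF assms(2), of i] i False assms(4) by auto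
  qed (use assms in simp)
qed

text \<open>Reverse-complement swaps the two summands and applies \<open>rc\<close> to each, and
  \<open>rc\<close> is an involution. The proof checks this on each half.\<close>

lemma centrosymmetric_perm_sum_rc:
  assumes "is_perm s"
  shows "centrosymmetric (perm_sum s (rc s))"
  unfolding centrosymmetric_def
proof (rule prod_eqI)
  let ?n = "psize s"
  have rc_inside: "1 \<le> snd (rc s) j" "snd (rc s) j \<le> ?n" if "1 \<le> j" "j \<le> ?n" for j
    using is_perm_inside[OF is_perm_rc[OF assms], of j] that by auto
  show "snd (rc (perm_sum s (rc s))) = snd (perm_sum s (rc s))"
  proof
    fix i
    consider "i = 0" | "1 \<le> i" "i \<le> ?n" | "?n < i" "i \<le> 2 * ?n" | "2 * ?n < i" by linarith
    then show "snd (rc (perm_sum s (rc s))) i = snd (perm_sum s (rc s)) i"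
    proof cases
      case 1
      then show ?thesis using assms by (simp add: rc_def perm_sum_def)
    next
      case 2
      then have "2 * ?n + 1 - i - ?n = ?n + 1 - i" by auto
      moreover have "snd (rc s) (?n + 1 - i) = ?n + 1 - snd s i"
        using 2 by (subst snd_rc) auto
      ultimately show ?thesis
        using 2 is_perm_inside[OF assms, of i]
        by (subst snd_rc) (auto simp: perm_sum_def mult_2)
    next
      case 3
      then have *: "snd (rc s) (i - ?n) = ?n + 1 - snd s (2 * ?n + 1 - i)"
        by (subst snd_rc) (auto simp: mult_2 intro!: arg_cong[of _ _ "snd s"])
      have "snd s (2 * ?n + 1 - i) \<le> ?n"
        using 3 by (intro is_perm_inside(2)[OF assms]) auto
      with 3 * show ?thesis
        by (subst snd_rc) (auto simp: perm_sum_def mult_2)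
    next
      case 4
      then have "snd (rc s) (i - ?n) = i - ?n"
        using is_perm_outside[OF is_perm_rc[OF assms], of "i - ?n"] by auto
      with 4 show ?thesis by (auto simp: rc_def perm_sum_def)
    qed
  qed
qed simp

section \<open>Counting\<close>

lemma finite_of_size: "perm_class C \<Longrightarrow> finite (of_size C n)"
  by (rule finite_subset[of _ "{n} \<times> {f. f permutes {1..n}}"])
     (auto simp: of_size_def perm_class_def is_perm_def finite_permutations)

lemma perm_class_is_perm: "perm_class C \<Longrightarrow> p \<in> C \<Longrightarrow> is_perm p"
  by (auto simp: perm_class_def)

lemma perm_class_pattern:
  "perm_class C \<Longrightarrow> p \<in> C \<Longrightarrow> is_perm q \<Longrightarrow> pattern_of q p \<Longrightarrow> q \<in> C"
  unfolding perm_class_def by blast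

lemma of_size_is_perm: "perm_class C \<Longrightarrow> p \<in> of_size C n \<Longrightarrow> is_perm p"
  by (auto simp: of_size_def perm_class_def)

lemma block_in_of_size:
  assumes "perm_class C" "p \<in> C" "cut p a" "cut p (a + m)" "a + m \<le> psize p"
  shows "block p a m \<in> of_size C m"
proof -
  have "is_perm p" using assms by (auto simp: perm_class_def)
  then have "is_perm (block p a m)" "pattern_of (block p a m) p"
    using assms by (auto intro: is_perm_block pattern_of_block)
  then show ?thesis using perm_class_pattern[OF assms(1,2)] by (simp add: of_size_def)
qed

text \<open>Summation is injective once the size of the first summand is fixed. This is the
  supermultiplicativity that Fekete's lemma needs.\<close>

lemma card_of_size_supermult:
  assumes "perm_class C" "sum_closed C"
  shows "card (of_size C m) * card (of_size C n) \<le> card (of_size C (m + n))"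
proof -
  let ?f = "\<lambda>(s, t). perm_sum s t"
  have "inj_on ?f (of_size C m \<times> of_size C n)"
  proof (rule inj_onI, clarify)
    fix s t s' t'
    assume "s \<in> of_size C m" "t \<in> of_size C n" "s' \<in> of_size C m" "t' \<in> of_size C n"
      and "perm_sum s t = perm_sum s' t'"
    then have "s = s' \<and> t = t'"
      by (intro perm_sum_inject) (auto simp: of_size_def dest: perm_class_is_perm[OF assms(1)])
    then show "s = s' \<and> t = t'" .
  qed
  moreover have "?f ` (of_size C m \<times> of_size C n) \<subseteq> of_size C (m + n)"
    using assms(2) by (auto simp: of_size_def sum_closed_def)
  ultimately show ?thesis
    using card_inj_on_le finite_of_size[OF assms(1)] by (metis card_cartesian_product)
qed

text \<open>The injection sends \<open>s\<close> to \<open>perm_sum s (rc s)\<close>, which stays in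
  \<open>C\<close> by rc-invariance and sum closure.\<close>

lemma card_of_size_le_centrosymmetric:
  assumes "perm_class C" "sum_closed C" "rc_invariant C"
  shows "card (of_size C n) \<le> card {p \<in> of_size C (2 * n). centrosymmetric p}"
proof (rule card_inj_on_le)
  let ?f = "\<lambda>s. perm_sum s (rc s)"
  show "inj_on ?f (of_size C n)"
  proof (rule inj_onI)
    fix s s' assume *: "s \<in> of_size C n" "s' \<in> of_size C n" "?f s = ?f s'"
    then have "is_perm s" "is_perm s'" by (auto dest: of_size_is_perm[OF assms(1)])
    then show "s = s'"
      using perm_sum_inject[of s s' "rc s" "rc s'"] * is_perm_rc by (auto simp: of_size_def)
  qed
  show "?f ` of_size C n \<subseteq> {p \<in> of_size C (2 * n). centrosymmetric p}"
  proof (rule image_subsetI)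
    fix s assume s: "s \<in> of_size C n"
    then have "s \<in> C" "is_perm s" by (auto simp: of_size_def dest: perm_class_is_perm[OF assms(1)])
    moreover from this have "rc s \<in> C" using assms(3) by (auto simp: rc_invariant_def)
    ultimately show "?f s \<in> {p \<in> of_size C (2 * n). centrosymmetric p}"
      using assms(2) s by (auto simp: of_size_def sum_closed_def centrosymmetric_perm_sum_rc)
  qed
qed (use finite_of_size[OF assms(1)] in auto)

text \<open>Split at the least positive cut \<open>k\<close>, which exists because \<open>n\<close>
  itself is one. The first block is indecomposable, since a proper cut of it would be an earlier cut
  of \<open>p\<close>.\<close>

lemma card_of_size_le_convolution:
  assumes C: "perm_class C" and "0 < n"
  shows "card (of_size C n)
    \<le> (\<Sum>k\<in>{1..n}. card {p \<in> of_size C k. sum_indecomposable p} * card (of_size C (n - k)))"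
proof -
  let ?I = "\<lambda>k. {p \<in> of_size C k. sum_indecomposable p}"
  let ?A = "\<lambda>k. {p \<in> of_size C n. cut p k \<and> (\<forall>j. 0 < j \<longrightarrow> j < k \<longrightarrow> \<not> cut p j)}"
  let ?f = "\<lambda>k p. (block p 0 k, block p k (n - k))"
  have "of_size C n \<subseteq> (\<Union>k\<in>{1..n}. ?A k)"
  proof
    fix p assume p: "p \<in> of_size C n"
    then have ip: "is_perm p" and sz: "psize p = n"
      by (auto simp: of_size_def dest: perm_class_is_perm[OF C])
    define k where "k = (LEAST k. 0 < k \<and> cut p k)"
    have ex: "0 < n \<and> cut p n" using cut_psize[OF ip] sz assms(2) by auto
    have "0 < k \<and> cut p k" unfolding k_def by (rule LeastI[of _ n]) (rule ex)
    moreover have "k \<le> n" unfolding k_def by (rule Least_le) (rule ex)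
    moreover have "\<not> cut p j" if "0 < j" "j < k" for j
      using not_less_Least[of j "\<lambda>k. 0 < k \<and> cut p k"] that by (auto simp: k_def)
    ultimately show "p \<in> (\<Union>k\<in>{1..n}. ?A k)" using p by auto
  qed
  then have "card (of_size C n) \<le> card (\<Union>k\<in>{1..n}. ?A k)"
    by (rule card_mono[rotated]) (use finite_of_size[OF C] in auto)
  also have "\<dots> \<le> (\<Sum>k\<in>{1..n}. card (?A k))" by (rule card_UN_le) simp
  also have "\<dots> \<le> (\<Sum>k\<in>{1..n}. card (?I k) * card (of_size C (n - k)))"
  proof (rule sum_mono)
    fix k assume k: "k \<in> {1..n}"
    have "inj_on (?f k) (?A k)"
    proof (rule inj_onI)
      fix p q assume *: "p \<in> ?A k" "q \<in> ?A k" "?f k p = ?f k q"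
      then have "is_perm p" "is_perm q" by (auto dest: of_size_is_perm[OF C])
      then show "p = q"
        using perm_sum_blocks[of p k] perm_sum_blocks[of q k] * k by (auto simp: of_size_def)
    qed
    moreover have "?f k ` ?A k \<subseteq> ?I k \<times> of_size C (n - k)"
    proof (rule image_subsetI)
      fix p assume p: "p \<in> ?A k"
      then have ip: "is_perm p" and sz: "psize p = n" and pC: "p \<in> C"
        by (auto simp: of_size_def dest: perm_class_is_perm[OF C])
      have b: "block p 0 k \<in> of_size C k" "block p k (n - k) \<in> of_size C (n - k)"
        using C p k sz pC ip cut_psize[OF ip] by (auto intro!: block_in_of_size)
      have "sum_indecomposable (block p 0 k)"
      proof (subst sum_indecomposable_iff_cut)
        show "is_perm (block p 0 k)" using b by (auto intro: of_size_is_perm[OF C])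
        show "\<forall>j. 0 < j \<longrightarrow> j < psize (block p 0 k) \<longrightarrow> \<not> cut (block p 0 k) j"
        proof (intro allI impI notI)
          fix j assume j: "0 < j" "j < psize (block p 0 k)" "cut (block p 0 k) j"
          have "cut p j"
            unfolding cut_def
          proof (intro allI impI)
            fix i assume i: "i \<le> j"
            show "snd p i \<le> j"
            proof (cases "i = 0")
              case False
              have "snd (block p 0 k) i \<le> j" using j(3) i by (simp add: cut_def)
              with False i j(2) show ?thesis by (simp add: block_def)
            qed (use ip in simp)
          qed
          then show False using p j by auto
        qed
      qed
      with b show "?f k p \<in> ?I k \<times> of_size C (n - k)" by auto
    qed
    ultimately have "card (?A k) \<le> card (?I k \<times> of_size C (n - k))"
      by (rule card_inj_on_le) (use finite_of_size[OF C] in auto)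
    then show "card (?A k) \<le> card (?I k) * card (of_size C (n - k))"
      by (simp add: card_cartesian_product)
  qed
  finally show ?thesis .
qed

text \<open>Split at the greatest cut \<open>k\<close> of the first half; by symmetry
  \<open>2 * n - k\<close> is a cut as well. The first block and the middle block determine
  \<open>p\<close>, the last \<open>k\<close> entries being reflections of the first
  \<open>k\<close>. Forgetting that the middle block is centrosymmetric leaves an upper bound in
  terms of all indecomposables.\<close>

lemma card_centrosymmetric_le_convolution:
  assumes C: "perm_class C"
  shows "card {p \<in> of_size C (2 * n). centrosymmetric p}
    \<le> (\<Sum>k\<le>n. card (of_size C k) * card {p \<in> of_size C (2 * (n - k)). sum_indecomposable p})"
proof -
  let ?I = "\<lambda>k. {p \<in> of_size C k. sum_indecomposable p}"
  let ?Z = "{p \<in> of_size C (2 * n). centrosymmetric p}"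
  let ?A = "\<lambda>k. {p \<in> ?Z. cut p k \<and> (\<forall>j. k < j \<longrightarrow> j \<le> n \<longrightarrow> \<not> cut p j)}"
  let ?f = "\<lambda>k p. (block p 0 k, block p k (2 * (n - k)))"
  have "?Z \<subseteq> (\<Union>k\<le>n. ?A k)"
  proof
    fix p assume p: "p \<in> ?Z"
    then have ip: "is_perm p" by (auto dest: of_size_is_perm[OF C])
    \<comment> \<open>The cut \<open>0\<close> guarantees existence. If \<open>k = n\<close>, the
      middle block is empty.\<close>
    define k where "k = (GREATEST k. k \<le> n \<and> cut p k)"
    have "k \<le> n \<and> cut p k"
      unfolding k_def by (rule GreatestI_nat[of _ 0 n]) (use ip in auto)
    moreover have "\<not> cut p j" if "k < j" "j \<le> n" for j
      using Greatest_le_nat[of "\<lambda>k. k \<le> n \<and> cut p k" j n] that by (auto simp: k_def)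
    ultimately show "p \<in> (\<Union>k\<le>n. ?A k)" using p by auto
  qed
  then have "card ?Z \<le> card (\<Union>k\<le>n. ?A k)"
    by (rule card_mono[rotated]) (use finite_of_size[OF C] in auto)
  also have "\<dots> \<le> (\<Sum>k\<le>n. card (?A k))" by (rule card_UN_le) simp
  also have "\<dots> \<le> (\<Sum>k\<le>n. card (of_size C k) * card (?I (2 * (n - k))))"
  proof (rule sum_mono)
    fix k assume k: "k \<in> {..n}"
    have k2: "2 * n - k = k + 2 * (n - k)" using k by auto
    have "inj_on (?f k) (?A k)"
    proof (rule inj_onI)
      fix p q assume *: "p \<in> ?A k" "q \<in> ?A k" "?f k p = ?f k q"
      then have ip: "is_perm p" "is_perm q" and cp: "cut p k" "cut q k"
        and sz: "psize p = 2 * n" "psize q = 2 * n"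
        and cs: "centrosymmetric p" "centrosymmetric q"
        by (auto simp: of_size_def dest: perm_class_is_perm[OF C])
      \<comment> \<open>The two blocks cover exactly these positions; the remaining ones are
        reflected into the first \<open>k\<close>.\<close>
      have low: "snd p i = snd q i" if "i \<le> 2 * n - k" for i
      proof (cases "i = 0")
        case False
        show ?thesis
        proof (cases "i \<le> k")
          case True
          then show ?thesis
            using False ip * snd_eq_block[of p 0 i k] snd_eq_block[of q 0 i k] by auto
        next
          case False
          with that k2 have "k < i" "i \<le> k + 2 * (n - k)" by auto
          then show ?thesis
            using ip cp * snd_eq_block[of p k i "2 * (n - k)"] snd_eq_block[of q k i "2 * (n - k)"]
            by auto
        qed
      qed (use ip in simp)
      have "snd p i = snd q i" for i
      proof -
        consider "i \<le> 2 * n - k" | "2 * n - k < i" "i \<le> 2 * n" | "2 * n < i" by linarith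
        then show ?thesis
        proof cases
          case 2
          with k have "snd p (2 * n + 1 - i) = snd q (2 * n + 1 - i)" by (intro low) auto
          with 2 show ?thesis
            using centrosymmetric_snd[OF cs(1), of i] centrosymmetric_snd[OF cs(2), of i] sz k
            by auto
        qed (use low ip sz in \<open>auto simp: is_perm_outside\<close>)
      qed
      then show "p = q" using sz by (auto intro!: prod_eqI)
    qed
    moreover have "?f k ` ?A k \<subseteq> of_size C k \<times> ?I (2 * (n - k))"
    proof (rule image_subsetI)
      fix p assume p: "p \<in> ?A k"
      then have ip: "is_perm p" and sz: "psize p = 2 * n" and pC: "p \<in> C"
        and cs: "centrosymmetric p" and cp: "cut p k"
        by (auto simp: of_size_def dest: perm_class_is_perm[OF C])
      have cp': "cut p (k + 2 * (n - k))"
        using centrosymmetric_cut[OF ip cs cp] sz k by (simp add: k2[symmetric])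
      let ?m = "block p k (2 * (n - k))"
      have b: "block p 0 k \<in> of_size C k" "?m \<in> of_size C (2 * (n - k))"
        using C k sz pC ip cp cp' by (auto intro!: block_in_of_size)
      have "sum_indecomposable ?m"
      proof (subst sum_indecomposable_iff_cut)
        show "is_perm ?m" using b by (auto intro: of_size_is_perm[OF C])
        show "\<forall>j. 0 < j \<longrightarrow> j < psize ?m \<longrightarrow> \<not> cut ?m j"
        proof (intro allI impI notI)
          fix j assume j: "0 < j" "j < psize ?m" "cut ?m j"
          have cj: "cut p (k + j)"
            unfolding cut_def
          proof (intro allI impI)
            fix i assume i: "i \<le> k + j"
            show "snd p i \<le> k + j"
            proof (cases "i \<le> k")
              case True
              then show ?thesis using cp by (auto simp: cut_def intro: trans_le_add1)
            next
              case False
              then have "snd p i = k + snd ?m (i - k)"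
                using i j ip cp by (intro snd_eq_block) auto
              moreover have "snd ?m (i - k) \<le> j" using j(3) i by (auto simp: cut_def)
              ultimately show ?thesis by simp
            qed
          qed
          show False
          \<comment> \<open>A cut in the first half contradicts the choice of \<open>k\<close>
            directly; one in the second half does so after reflection.\<close>
          proof (cases "k + j \<le> n")
            case True
            then show False using p cj j by auto
          next
            case False
            have "cut p (2 * n - (k + j))"
              using centrosymmetric_cut[OF ip cs cj] sz j k by auto
            moreover have "k < 2 * n - (k + j)" "2 * n - (k + j) \<le> n"
              using False j k by auto
            ultimately show False using p by auto
          qed
        qed
      qed
      with b show "?f k p \<in> of_size C k \<times> ?I (2 * (n - k))" by auto
    qed
    ultimately have "card (?A k) \<le> card (of_size C k \<times> ?I (2 * (n - k)))"
      by (rule card_inj_on_le) (use finite_of_size[OF C] in auto)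
    then show "card (?A k) \<le> card (of_size C k) * card (?I (2 * (n - k)))"
      by (simp add: card_cartesian_product)
  qed
  finally show ?thesis .
qed

section \<open>Indecomposable patterns of an indecomposable permutation\<close>

text \<open>The count of elements up to \<open>x\<close> is weakly increasing and jumps at every
  element of \<open>S\<close>; hence only \<open>y\<close> has to lie in \<open>S\<close>.\<close>

lemma rank_mono_iff:
  fixes S :: "nat set"
  assumes "finite S" "y \<in> S"
  shows "card {z \<in> S. z \<le> x} < card {z \<in> S. z \<le> y} \<longleftrightarrow> x < y"
proof
  assume "x < y"
  then have "{z \<in> S. z \<le> x} \<subseteq> {z \<in> S. z \<le> y}"
    and "y \<in> {z \<in> S. z \<le> y}" "y \<notin> {z \<in> S. z \<le> x}"
    using assms(2) by auto
  then show "card {z \<in> S. z \<le> x} < card {z \<in> S. z \<le> y}"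
    using assms(1) by (intro psubset_card_mono psubsetI) (simp, assumption, metis)
next
  assume *: "card {z \<in> S. z \<le> x} < card {z \<in> S. z \<le> y}"
  show "x < y"
  proof (rule ccontr)
    assume "\<not> x < y"
    then have "card {z \<in> S. z \<le> y} \<le> card {z \<in> S. z \<le> x}"
      using assms by (intro card_mono) auto
    with * show False by simp
  qed
qed

lemma rank_bij_betw:
  fixes S :: "nat set"
  assumes "finite S"
  shows "bij_betw (\<lambda>x. card {z \<in> S. z \<le> x}) S {1..card S}"
proof -
  let ?r = "\<lambda>x. card {z \<in> S. z \<le> x}"
  have inj: "inj_on ?r S"
  proof (rule linorder_inj_onI)
    fix x y assume "x < y" "y \<in> S"
    then show "?r x \<noteq> ?r y" using rank_mono_iff[OF assms, of y x] by simp
  qed auto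
  moreover have "?r ` S \<subseteq> {1..card S}"
  proof
    fix k assume "k \<in> ?r ` S"
    then obtain x where "x \<in> S" "k = ?r x" by auto
    moreover from this have "0 < ?r x" using assms by (auto simp: card_gt_0_iff)
    moreover have "?r x \<le> card S" using assms by (intro card_mono) auto
    ultimately show "k \<in> {1..card S}" by auto
  qed
  ultimately have "?r ` S = {1..card S}"
    by (intro card_subset_eq) (auto simp: card_image)
  with inj show ?thesis by (simp add: bij_betw_def)
qed

lemma increasing_enumeration:
  fixes S :: "nat set"
  assumes "finite S"
  obtains f where "bij_betw f {1..card S} S"
    and "\<And>i j. i \<in> {1..card S} \<Longrightarrow> j \<in> {1..card S} \<Longrightarrow> f i < f j \<longleftrightarrow> i < j"
proof
  let ?r = "\<lambda>x. card {z \<in> S. z \<le> x}"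
  let ?f = "inv_into S ?r"
  show bij: "bij_betw ?f {1..card S} S"
    by (rule bij_betw_inv_into) (rule rank_bij_betw[OF assms])
  fix i j assume ij: "i \<in> {1..card S}" "j \<in> {1..card S}"
  then have "?f j \<in> S" using bij by (auto simp: bij_betw_def)
  moreover have "?r (?f i) = i" "?r (?f j) = j"
    using ij rank_bij_betw[OF assms] by (auto intro!: bij_betw_inv_into_right)
  ultimately show "?f i < ?f j \<longleftrightarrow> i < j"
    using rank_mono_iff[OF assms, of "?f j" "?f i"] by simp
qed

text \<open>The pattern \<open>q\<close> that \<open>p\<close> induces on \<open>S\<close>:
  \<open>f\<close> lists \<open>S\<close> in increasing order, and each value is replaced by its
  rank among the values of \<open>p\<close> on \<open>S\<close>.\<close>

lemma standardization:
  assumes "is_perm p" "S \<subseteq> {1..psize p}"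
  obtains q f where "is_perm q" "psize q = card S" "bij_betw f {1..card S} S"
    and "\<And>i j. i \<in> {1..card S} \<Longrightarrow> j \<in> {1..card S} \<Longrightarrow> f i < f j \<longleftrightarrow> i < j"
    and "\<And>i j. i \<in> {1..card S} \<Longrightarrow> j \<in> {1..card S} \<Longrightarrow>
           snd q i < snd q j \<longleftrightarrow> snd p (f i) < snd p (f j)"
proof -
  have fin: "finite S" using assms(2) finite_subset by blast
  obtain f where f: "bij_betw f {1..card S} S"
    and fm: "\<And>i j. i \<in> {1..card S} \<Longrightarrow> j \<in> {1..card S} \<Longrightarrow> f i < f j \<longleftrightarrow> i < j"
    using increasing_enumeration[OF fin] by blast
  define T where "T = snd p ` S"
  define r where "r x = card {z \<in> T. z \<le> x}" for x
  define q where "q = (card S, \<lambda>i. if i \<in> {1..card S} then r (snd p (f i)) else i)"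
  have finT: "finite T" using fin by (simp add: T_def)
  have cT: "card T = card S"
    unfolding T_def by (rule card_image) (auto simp: inj_on_def is_perm_inj[OF assms(1)])
  have fT: "snd p (f i) \<in> T" if "i \<in> {1..card S}" for i
    using f that by (auto simp: T_def bij_betw_def)
  have ord: "snd q i < snd q j \<longleftrightarrow> snd p (f i) < snd p (f j)"
    if "i \<in> {1..card S}" "j \<in> {1..card S}" for i j
    using rank_mono_iff[OF finT fT[OF that(2)], of "snd p (f i)"] that by (simp add: q_def r_def)
  have "is_perm q"
  proof (rule is_permI)
    fix i assume "1 \<le> i" "i \<le> psize q"
    then have i: "i \<in> {1..card S}" by (simp add: q_def)
    have "r (snd p (f i)) \<in> {1..card S}"
      using rank_bij_betw[OF finT] fT[OF i] unfolding cT r_def bij_betw_def by blast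
    then show "1 \<le> snd q i \<and> snd q i \<le> psize q" using i by (simp add: q_def)
  next
    fix i j assume "1 \<le> i" "i < j" "j \<le> psize q"
    then have ij: "i \<in> {1..card S}" "j \<in> {1..card S}" "i < j" by (auto simp: q_def)
    then have "snd p (f i) \<noteq> snd p (f j)"
      using fm[of i j] by (auto simp: is_perm_inj[OF assms(1)])
    then show "snd q i \<noteq> snd q j" using ord[of i j] ord[of j i] ij by auto
  qed (auto simp: q_def)
  moreover have "psize q = card S" by (simp add: q_def)
  ultimately show ?thesis using that f fm ord by blast
qed

text \<open>
  Components of an inversion graph are intervals, so connectedness of the subgraph induced by \<open>S\<close>
  only has to be tested against initial segments.
\<close>

definition inversion_connected :: "sized_perm \<Rightarrow> nat set \<Rightarrow> bool" where
  "inversion_connected p S \<longleftrightarrow>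
     (\<forall>k. (\<exists>i\<in>S. i \<le> k) \<longrightarrow> (\<exists>j\<in>S. k < j) \<longrightarrow>
        (\<exists>i\<in>S. \<exists>j\<in>S. i \<le> k \<and> k < j \<and> snd p j < snd p i))"

section \<open>Growing connected sets in the inversion graph\<close>

text \<open>As \<open>k\<close> is not a cut, a value above \<open>k\<close> stands at a position up
  to \<open>k\<close>. By pigeonhole some value up to \<open>k\<close> stands further right, and the
  two form an inversion across \<open>k\<close>.\<close>

lemma crossing_inversion:
  assumes "is_perm p" "sum_indecomposable p" "0 < k" "k < psize p"
  obtains i j where "1 \<le> i" "i \<le> k" "k < j" "j \<le> psize p" "snd p j < snd p i"
proof -
  have "\<not> cut p k" using assms sum_indecomposable_iff_cut by blast
  then obtain i where i: "i \<le> k" "k < snd p i" by (auto simp: cut_def not_le)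
  have "\<exists>j>k. snd p j \<le> k"
  proof (rule ccontr)
    assume no: "\<not> (\<exists>j>k. snd p j \<le> k)"
    have "{..k} \<subseteq> snd p ` ({..k} - {i})"
    proof
      fix v assume v: "v \<in> {..k}"
      have "surj (snd p)" using assms(1) by (auto simp: is_perm_def permutes_surj)
      then obtain x where x: "v = snd p x" by (metis surjD)
      with v no have "x \<le> k" by (metis atMost_iff not_le)
      moreover have "x \<noteq> i" using x v i by auto
      ultimately show "v \<in> snd p ` ({..k} - {i})" using x by auto
    qed
    then have "card {..k} \<le> card ({..k} - {i})" by (meson finite_Diff finite_atMost surj_card_le)
    also have "\<dots> < card {..k}" using i by (intro psubset_card_mono) auto
    finally show False by simp
  qed
  then obtain j where j: "k < j" "snd p j \<le> k" by blast
  have "1 \<le> i" using i assms(1) by (cases "i = 0") auto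
  moreover have "j \<le> psize p" using j is_perm_outside[OF assms(1), of j] by linarith
  ultimately show ?thesis using that i j by (meson le_less_trans)
qed

text \<open>The last hypothesis says that \<open>v\<close> and \<open>s\<close> are adjacent in the
  inversion graph. The only new thresholds separate \<open>v\<close> from all of \<open>S\<close>,
  and the inversion of \<open>v\<close> with \<open>s\<close> crosses them.\<close>

lemma inversion_connected_insert:
  assumes "inversion_connected p S" "s \<in> S"
    and "v < s \<and> snd p s < snd p v \<or> s < v \<and> snd p v < snd p s"
  shows "inversion_connected p (insert v S)"
  unfolding inversion_connected_def
proof (intro allI impI)
  fix k assume *: "\<exists>i\<in>insert v S. i \<le> k" "\<exists>j\<in>insert v S. k < j"
  show "\<exists>i\<in>insert v S. \<exists>j\<in>insert v S. i \<le> k \<and> k < j \<and> snd p j < snd p i"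
  proof (cases "(\<exists>i\<in>S. i \<le> k) \<and> (\<exists>j\<in>S. k < j)")
    case True
    with assms(1) show ?thesis unfolding inversion_connected_def by (meson insertI2)
  next
    case False
    then consider "v \<le> k" "k < s" | "s \<le> k" "k < v"
      using * assms(2) by (metis insertE not_le)
    then show ?thesis using assms(2,3) by cases auto
  qed
qed

text \<open>It suffices to find a neighbour of \<open>S\<close> outside \<open>S\<close>. A gap
  inside \<open>S\<close> is such a neighbour; if there is none, \<open>S\<close> is an interval and
  an inversion across one of its ends leads to one.\<close>

lemma inversion_connected_extend:
  assumes p: "is_perm p" "sum_indecomposable p"
    and S: "S \<subseteq> {1..psize p}" "S \<noteq> {}" "S \<noteq> {1..psize p}" "inversion_connected p S"
  obtains v where "v \<in> {1..psize p} - S" "inversion_connected p (insert v S)"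
proof -
  have "\<exists>v\<in>{1..psize p} - S. \<exists>s\<in>S.
      v < s \<and> snd p s < snd p v \<or> s < v \<and> snd p v < snd p s"
  proof (cases "\<exists>v\<in>{1..psize p} - S. (\<exists>i\<in>S. i \<le> v) \<and> (\<exists>j\<in>S. v < j)")
    case True
    then obtain v where v: "v \<in> {1..psize p} - S" "\<exists>i\<in>S. i \<le> v" "\<exists>j\<in>S. v < j" by blast
    then obtain i j where ij: "i \<in> S" "j \<in> S" "i \<le> v" "v < j" "snd p j < snd p i"
      using S(4) unfolding inversion_connected_def by blast
    moreover have "i < v" using ij v by (cases "i = v") auto
    \<comment> \<open>Position \<open>v\<close> lies between the ends of an inversion, so its value
      is out of order with at least one of them.\<close>
    ultimately have "snd p v < snd p i \<or> snd p j < snd p v" by linarith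
    then show ?thesis using v ij \<open>i < v\<close> by blast
  next
    case False
    have fin: "finite S" using S(1) finite_subset by blast
    define l r where "l = Min S" and "r = Max S"
    have lr: "l \<in> S" "r \<in> S" "\<And>s. s \<in> S \<Longrightarrow> l \<le> s \<and> s \<le> r"
      using fin S(2) by (auto simp: l_def r_def)
    have bounds: "1 \<le> l" "l \<le> r" "r \<le> psize p" using lr S(1) by auto
    have seg: "v \<in> S" if "l \<le> v" "v \<le> r" for v
    proof (rule ccontr)
      assume "v \<notin> S"
      with that lr bounds have "v \<in> {1..psize p} - S" "v \<noteq> r" by auto
      with that lr False show False by (metis le_neq_implies_less)
    qed
    show ?thesis
    proof (cases "r < psize p")
      case True
      with bounds obtain i j where ij: "1 \<le> i" "i \<le> r" "r < j" "j \<le> psize p" "snd p j < snd p i"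
        using crossing_inversion[OF p, of r] by auto
      have jS: "j \<in> {1..psize p} - S" using ij lr(3)[of j] by auto
      show ?thesis
      proof (cases "i \<in> S")
        case True
        then show ?thesis using ij jS by (meson le_less_trans)
      next
        case False
        with ij seg have "i < l" by (meson not_le)
        with False ij have "i \<in> {1..psize p} - S" "i < r" "i < j" using bounds by auto
        \<comment> \<open>The inversion jumps over all of \<open>S\<close>. Its ends enclose
          \<open>r\<close>, which therefore forms an inversion with one of them.\<close>
        moreover have "snd p r < snd p i \<or> snd p j < snd p r" using ij by linarith
        ultimately show ?thesis using ij jS lr by blast
      qed
    next
      \<comment> \<open>Now \<open>S\<close> reaches the right end, so the left end is used: an
        inversion across \<open>l - 1\<close> must end in \<open>S\<close>.\<close>
      case False
      with bounds have r: "r = psize p" by simp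
      have "l \<noteq> 1"
      proof
        assume "l = 1"
        then have "{1..psize p} \<subseteq> S" using seg r by auto
        with S show False by blast
      qed
      with bounds r have "0 < l - 1" "l - 1 < psize p" by auto
      then obtain i j
        where ij: "1 \<le> i" "i \<le> l - 1" "l - 1 < j" "j \<le> psize p" "snd p j < snd p i"
        by (rule crossing_inversion[OF p])
      then have "j \<in> S" using seg r by auto
      moreover have "i \<in> {1..psize p} - S" "i < j" using ij lr(3)[of i] bounds \<open>l \<noteq> 1\<close> by auto
      ultimately show ?thesis using ij by blast
    qed
  qed
  then show ?thesis using that inversion_connected_insert[OF S(4)] by blast
qed

lemma ex_inversion_connected:
  assumes "is_perm p" "sum_indecomposable p" "1 \<le> m" "m \<le> psize p"
  shows "\<exists>S\<subseteq>{1..psize p}. card S = m \<and> inversion_connected p S"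
  using assms(3,4)
proof (induction m rule: nat_induct_at_least)
  case base
  then show ?case
    by (intro exI[of _ "{1}"]) (auto simp: inversion_connected_def)
next
  case (Suc m)
  then obtain S where S: "S \<subseteq> {1..psize p}" "card S = m" "inversion_connected p S" by auto
  moreover have "S \<noteq> {}" "S \<noteq> {1..psize p}" using Suc S by auto
  ultimately obtain v where v: "v \<in> {1..psize p} - S" "inversion_connected p (insert v S)"
    using inversion_connected_extend[OF assms(1,2)] by blast
  moreover have "card (insert v S) = Suc m"
    using S v finite_subset[OF S(1)] by auto
  ultimately show ?case using S by (intro exI[of _ "insert v S"]) auto
qed

text \<open>Standardize a connected set \<open>S\<close> of \<open>m\<close> positions. A proper cut
  \<open>k\<close> of the pattern would correspond to the threshold \<open>f k\<close> in
  \<open>S\<close>, where connectedness supplies an inversion that carries over to the pattern and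
  crosses the cut.\<close>

lemma indecomposable_pattern_of_size:
  assumes p: "is_perm p" "sum_indecomposable p" and m: "1 \<le> m" "m \<le> psize p"
  obtains q where "is_perm q" "sum_indecomposable q" "psize q = m" "pattern_of q p"
proof -
  obtain S where S: "S \<subseteq> {1..psize p}" "card S = m" "inversion_connected p S"
    using ex_inversion_connected[OF assms] by blast
  obtain q f where q: "is_perm q" "psize q = m" and f: "bij_betw f {1..m} S"
    and fm: "\<And>i j. i \<in> {1..m} \<Longrightarrow> j \<in> {1..m} \<Longrightarrow> f i < f j \<longleftrightarrow> i < j"
    and ord: "\<And>i j. i \<in> {1..m} \<Longrightarrow> j \<in> {1..m} \<Longrightarrow>
           snd q i < snd q j \<longleftrightarrow> snd p (f i) < snd p (f j)"
    using standardization[OF p(1) S(1)] unfolding S(2) by blast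
  have img: "f ` {1..m} = S" using f by (simp add: bij_betw_def)
  have "pattern_of q p"
    unfolding pattern_of_def q(2)
  proof (intro exI[of _ f] conjI ballI)
    show "f ` {1..m} \<subseteq> {1..psize p}" using img S(1) by simp
    show "strict_mono_on {1..m} f" unfolding strict_mono_on_def using fm by simp
  qed (rule ord)
  moreover have "sum_indecomposable q"
  proof (subst sum_indecomposable_iff_cut[OF q(1)], intro allI impI notI)
    fix k assume k: "0 < k" "k < psize q" "cut q k"
    have "f k \<in> S" "f (Suc k) \<in> S" "f k < f (Suc k)"
      using img k q(2) fm[of k "Suc k"] by auto
    then obtain x y where xy: "x \<in> S" "y \<in> S" "x \<le> f k" "f k < y" "snd p y < snd p x"
      using S(3) unfolding inversion_connected_def by (meson order_refl)
    then obtain i j where ij: "i \<in> {1..m}" "j \<in> {1..m}" "x = f i" "y = f j"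
      using img by blast
    have "i \<le> k" "k < j"
      using xy ij fm[of k i] fm[of k j] k q(2) by (auto simp: not_less[symmetric])
    then have "snd q i \<le> k" "k < snd q j"
      using k(3) cut_gt[OF q(1) k(3)] by (auto simp: cut_def)
    then show False using ord[of j i] ij xy by auto
  qed
  ultimately show ?thesis using that q by blast
qed

section \<open>Growth rates\<close>

lemma le_power_root_bound:
  fixes x y :: real
  assumes "0 < n" "0 \<le> x" "root n x \<le> y"
  shows "x \<le> y ^ n"
  using power_mono[OF assms(3), of n] assms by (simp add: real_root_pow_pos2)

text \<open>Fekete's lemma in multiplicative form: the limit is the supremum of the roots, which the
  bound by powers of \<open>M\<close> makes finite.\<close>

lemma supermultiplicative_root_limit:
  fixes a :: "nat \<Rightarrow> real"
  assumes ge1: "\<And>n. 1 \<le> a n" and super: "\<And>m n. a m * a n \<le> a (m + n)"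
    and bound: "\<And>n. a n \<le> M ^ n"
  obtains L where "1 \<le> L" "\<And>n. a n \<le> L ^ n" "(\<lambda>n. root n (a n)) \<longlonglongrightarrow> L"
proof
  \<comment> \<open>The index starts at \<open>1\<close> because \<open>root 0\<close> is
    \<open>0\<close> by convention.\<close>
  define L where "L = (SUP n\<in>{1..}. root n (a n))"
  have M: "1 \<le> M" using ge1[of 1] bound[of 1] by simp
  have "root n (a n) \<le> M" if "n \<ge> 1" for n
    using real_root_le_mono[of n "a n" "M ^ n"] bound[of n] that M
    by (simp add: real_root_power_cancel)
  then have bdd: "bdd_above ((\<lambda>n. root n (a n)) ` {1..})" by (intro bdd_aboveI[of _ M]) auto
  have leL: "root n (a n) \<le> L" if "n \<ge> 1" for n
    unfolding L_def using bdd that by (intro cSUP_upper) auto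
  have root1: "1 \<le> root n (a n)" if "n \<ge> 1" for n using ge1[of n] that by simp
  show "1 \<le> L" using root1[of 1] leL[of 1] by simp
  show "a n \<le> L ^ n" for n
  proof (cases "n = 0")
    case True then show ?thesis using bound[of 0] by simp
  next
    case False
    then show ?thesis using leL[of n] ge1[of n] by (intro le_power_root_bound) auto
  qed
  have pow: "a m ^ q \<le> a (q * m)" for m q
  proof (induction q)
    case 0 show ?case using ge1[of 0] by simp
  next
    case (Suc q)
    have "a m ^ Suc q \<le> a m * a (q * m)" using Suc ge1[of m] by (simp add: mult_left_mono)
    also have "\<dots> \<le> a (Suc q * m)" using super[of m "q * m"] by simp
    finally show ?case .
  qed
  show "(\<lambda>n. root n (a n)) \<longlonglongrightarrow> L"
  proof (rule order_tendstoI)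
    fix x assume "x < L"
    show "eventually (\<lambda>n. x < root n (a n)) sequentially"
    proof (cases "x < 1")
      case True
      then show ?thesis
        using root1 by (intro eventually_sequentiallyI[of 1]) (meson less_le_trans)
    next
      case False
      obtain z where z: "x < z" "z < L" using dense[OF \<open>x < L\<close>] by blast
      have z1: "1 < z" using z False by simp
      obtain m where m: "m \<ge> 1" "z < root m (a m)"
        using z(2) bdd unfolding L_def by (subst (asm) less_cSUP_iff) auto
      have zm: "z ^ m \<le> a m"
        using power_mono[of z "root m (a m)" m] m z1 ge1[of m] by (simp add: real_root_pow_pos2)
      \<comment> \<open>Dividing \<open>n\<close> by \<open>m\<close> with remainder costs at most
        the constant factor \<open>z ^ m\<close>, whose \<open>n\<close>-th root tends to
        \<open>1\<close>.\<close>
      have lower: "z / root n (z ^ m) \<le> root n (a n)" if n: "n \<ge> 1" for n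
      proof -
        have "z ^ n = z ^ (n div m * m + n mod m)" by simp
        also have "\<dots> \<le> z ^ (n div m * m + m)"
          using m z1 by (intro power_increasing add_left_mono) (auto simp: less_imp_le)
        also have "\<dots> = (z ^ m) ^ (n div m) * z ^ m"
          by (simp add: power_add power_mult[symmetric] mult.commute)
        also have "\<dots> \<le> a n * z ^ m"
        proof (rule mult_right_mono)
          have "(z ^ m) ^ (n div m) \<le> a m ^ (n div m)"
            using zm z1 by (intro power_mono) auto
          also have "\<dots> \<le> a (n div m * m)" by (rule pow)
          also have "\<dots> \<le> a (n div m * m) * a (n mod m)"
            using mult_left_mono[OF ge1[of "n mod m"], of "a (n div m * m)"] ge1[of "n div m * m"]
            by simp
          also have "\<dots> \<le> a n" using super[of "n div m * m" "n mod m"] by simp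
          finally show "(z ^ m) ^ (n div m) \<le> a n" .
        qed (use z1 in simp)
        finally have "z ^ n / z ^ m \<le> a n" using z1 by (simp add: divide_le_eq)
        then have "root n (z ^ n / z ^ m) \<le> root n (a n)" using n by simp
        then show ?thesis using n z1 by (simp add: real_root_divide real_root_power_cancel)
      qed
      have "(\<lambda>n. z / root n (z ^ m)) \<longlonglongrightarrow> z / 1"
        using z1 by (intro tendsto_intros LIMSEQ_root_const) auto
      then have "eventually (\<lambda>n. x < z / root n (z ^ m)) sequentially"
        using z by (auto dest: order_tendstoD)
      then show ?thesis
        using eventually_ge_at_top[of 1] by eventually_elim (use lower in force)
    qed
  next
    fix x assume "L < x"
    then show "eventually (\<lambda>n. root n (a n) < x) sequentially"
      using leL by (intro eventually_sequentiallyI[of 1]) (meson le_less_trans)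
  qed
qed

text \<open>The powers of \<open>2\<close> cancel the growth of \<open>c\<close>, leaving a
  recurrence with constant coefficient \<open>K\<close>. Powers of \<open>K + 1\<close> solve it, as
  \<open>K\<close> times their geometric sum is \<open>(K + 1) ^ n - 1\<close>.\<close>

lemma convolution_geometric_bound:
  fixes a c :: "nat \<Rightarrow> real"
  assumes "a 0 \<le> 1" "\<And>n. 0 \<le> a n" "0 \<le> K" "\<And>k. c k \<le> K * 2 ^ k"
    and conv: "\<And>n. 0 < n \<Longrightarrow> a n \<le> (\<Sum>k\<in>{1..n}. c k * a (n - k))"
  shows "a n \<le> (2 * (K + 1)) ^ n"
proof (induction n rule: less_induct)
  case (less n)
  show ?case
  proof (cases "n = 0")
    case True then show ?thesis using assms(1) by simp
  next
    case False
    have "a n \<le> (\<Sum>k\<in>{1..n}. c k * a (n - k))" using conv False by simp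
    also have "\<dots> \<le> (\<Sum>k\<in>{1..n}. (K * 2 ^ k) * (2 * (K + 1)) ^ (n - k))"
      using assms(2-4) less by (intro sum_mono mult_mono) auto
    also have "\<dots> = (\<Sum>k\<in>{1..n}. (2 ^ n * K) * (K + 1) ^ (n - k))"
    proof (rule sum.cong)
      fix k assume "k \<in> {1..n}"
      then have "(2::real) ^ n = 2 ^ k * 2 ^ (n - k)" by (simp flip: power_add)
      then show "(K * 2 ^ k) * (2 * (K + 1)) ^ (n - k) = (2 ^ n * K) * (K + 1) ^ (n - k)"
        unfolding power_mult_distrib by simp
    qed simp
    also have "\<dots> = (2 ^ n * K) * (\<Sum>k\<in>{1..n}. (K + 1) ^ (n - k))"
      by (simp add: sum_distrib_left)
    also have "(\<Sum>k\<in>{1..n}. (K + 1) ^ (n - k)) = (\<Sum>j<n. (K + 1) ^ j)"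
      by (rule sum.reindex_bij_witness[of _ "\<lambda>j. n - j" "\<lambda>k. n - k"]) auto
    also have "2 ^ n * K * \<dots> = 2 ^ n * ((K + 1) ^ n - 1)"
      by (simp add: power_diff_1_eq)
    also have "\<dots> \<le> (2 * (K + 1)) ^ n" unfolding power_mult_distrib by simp
    finally show ?thesis .
  qed
qed

lemma geometric_bound_of_root_limit:
  fixes c :: "nat \<Rightarrow> real"
  assumes lim: "(\<lambda>n. root n (c n)) \<longlonglongrightarrow> l" and "l < y" "1 \<le> y" and nonneg: "\<And>n. 0 \<le> c n"
  obtains K where "0 < K" "\<And>n. c n \<le> K * y ^ n"
proof -
  have "eventually (\<lambda>n. root n (c n) < y) sequentially"
    using order_tendstoD(2)[OF lim \<open>l < y\<close>] .
  then obtain N where N: "\<And>n. n \<ge> N \<Longrightarrow> root n (c n) < y"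
    by (auto simp: eventually_sequentially)
  \<comment> \<open>The early terms are absorbed in \<open>K\<close>. They always include index
    \<open>0\<close>, where \<open>root 0\<close> tells nothing about \<open>c 0\<close>.\<close>
  define K where "K = 1 + (\<Sum>n\<le>N. c n)"
  have K1: "1 \<le> K" using nonneg by (auto simp: K_def intro: sum_nonneg)
  have "c n \<le> K * y ^ n" for n
  proof (cases "n \<le> N")
    case True
    then have "c n \<le> K" using member_le_sum[of n "{..N}" c] nonneg by (auto simp: K_def)
    also have "\<dots> \<le> K * y ^ n" using K1 \<open>1 \<le> y\<close> by (simp add: mult_le_cancel_left1)
    finally show ?thesis .
  next
    case False
    then have "c n \<le> y ^ n" using N[of n] nonneg by (intro le_power_root_bound) auto
    also have "\<dots> \<le> K * y ^ n" using K1 \<open>1 \<le> y\<close> by (simp add: mult_le_cancel_right1)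
    finally show ?thesis .
  qed
  then show ?thesis using that K1 by (metis less_le_trans zero_less_one)
qed

text \<open>The lower bound is \<open>a n \<le> b n\<close>. Above, each of the \<open>n + 1\<close>
  summands is at most a constant times \<open>w ^ n\<close>, for any \<open>w > L\<close>, and
  \<open>n\<close>-th roots remove the polynomial factor.\<close>

lemma root_limit_squeeze:
  fixes a b c :: "nat \<Rightarrow> real"
  assumes lim: "(\<lambda>n. root n (a n)) \<longlonglongrightarrow> L" and "1 \<le> L"
    and a: "\<And>n. 0 \<le> a n" "\<And>n. a n \<le> L ^ n"
    and c: "\<And>n. 0 \<le> c n" "\<And>y. 1 < y \<Longrightarrow> \<exists>K>0. \<forall>n. c n \<le> K * y ^ n"
    and ab: "\<And>n. a n \<le> b n" and bc: "\<And>n. b n \<le> (\<Sum>k\<le>n. a k * c (2 * (n - k)))"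
  shows "(\<lambda>n. root n (b n)) \<longlonglongrightarrow> L"
proof (rule order_tendstoI)
  fix x assume "x < L"
  then have "eventually (\<lambda>n. x < root n (a n)) sequentially" using lim by (auto dest: order_tendstoD)
  then show "eventually (\<lambda>n. x < root n (b n)) sequentially"
    using eventually_gt_at_top[of 0]
    by eventually_elim (use ab real_root_le_mono less_le_trans in blast)
next
  fix z assume "L < z"
  then obtain w where w: "L < w" "w < z" using dense by blast
  \<comment> \<open>The index \<open>2 * (n - k)\<close> of \<open>c\<close> turns \<open>y\<close>
    into its square. With this choice both \<open>L\<close> and the square of \<open>y\<close> are
    at most \<open>w\<close>.\<close>
  define y where "y = sqrt (w / L)"
  have y1: "1 < y" using w \<open>1 \<le> L\<close> by (simp add: y_def)
  have y2: "L * y\<^sup>2 = w" using w \<open>1 \<le> L\<close> by (simp add: y_def)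
  obtain K where K: "0 < K" "\<And>n. c n \<le> K * y ^ n" using c(2)[OF y1] by blast
  have upper: "root n (b n) \<le> root n (real n) * root n (2 * K) * w" if n: "n \<ge> 1" for n
  proof -
    have "b n \<le> (\<Sum>k\<le>n. a k * c (2 * (n - k)))" by (rule bc)
    also have "\<dots> \<le> (\<Sum>k\<le>n. K * w ^ n)"
    proof (rule sum_mono)
      fix k assume k: "k \<in> {..n}"
      have "a k * c (2 * (n - k)) \<le> L ^ k * (K * y ^ (2 * (n - k)))"
        using a c(1) K \<open>1 \<le> L\<close> by (intro mult_mono) auto
      also have "\<dots> = K * (L ^ k * (y\<^sup>2) ^ (n - k))" by (simp add: power_mult)
      also have "\<dots> \<le> K * (w ^ k * w ^ (n - k))"
      proof (intro mult_left_mono mult_mono power_mono)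
        show "y\<^sup>2 \<le> w" using y2 \<open>1 \<le> L\<close> mult_right_mono[of 1 L "y\<^sup>2"] by simp
      qed (use w \<open>1 \<le> L\<close> K in auto)
      also have "\<dots> = K * w ^ n" using k by (simp flip: power_add)
      finally show "a k * c (2 * (n - k)) \<le> K * w ^ n" .
    qed
    also have "\<dots> = (real n + 1) * (K * w ^ n)" by simp
    also have "\<dots> \<le> (2 * real n) * (K * w ^ n)"
      using n K w \<open>1 \<le> L\<close> by (intro mult_right_mono) auto
    also have "\<dots> = real n * (2 * K) * w ^ n" by simp
    finally have "root n (b n) \<le> root n (real n * (2 * K) * w ^ n)" using n by simp
    also have "\<dots> = root n (real n) * root n (2 * K) * w"
      using n w \<open>1 \<le> L\<close> by (simp add: real_root_mult real_root_power_cancel)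
    finally show ?thesis .
  qed
  have "(\<lambda>n. root n (real n) * root n (2 * K) * w) \<longlonglongrightarrow> 1 * 1 * w"
    using K by (intro tendsto_intros LIMSEQ_root LIMSEQ_root_const) auto
  then have "eventually (\<lambda>n. root n (real n) * root n (2 * K) * w < z) sequentially"
    using w by (auto dest: order_tendstoD)
  then show "eventually (\<lambda>n. root n (b n) < z) sequentially"
    using eventually_ge_at_top[of 1] by eventually_elim (use upper in force)
qed

text \<open>By \<open>down\<close>, one zero at a positive index makes all later terms zero.
  Otherwise the terms at positive indices lie between \<open>1\<close> and a constant, and so the
  roots tend to \<open>1\<close>.\<close>

lemma root_limit_0_or_1:
  fixes c :: "nat \<Rightarrow> nat"
  assumes bdd: "Bseq (\<lambda>n. real (c n))"
    and down: "\<And>m n. 1 \<le> m \<Longrightarrow> m \<le> n \<Longrightarrow> 0 < c n \<Longrightarrow> 0 < c m"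
  shows "(\<lambda>n. root n (real (c n))) \<longlonglongrightarrow> 0 \<or> (\<lambda>n. root n (real (c n))) \<longlonglongrightarrow> 1"
proof (cases "\<exists>m\<ge>1. c m = 0")
  case True
  then obtain m where "1 \<le> m" "c m = 0" by blast
  then have "c n = 0" if "m \<le> n" for n using down[of m n] that by auto
  then have "eventually (\<lambda>n. root n (real (c n)) = 0) sequentially"
    by (intro eventually_sequentiallyI[of m]) simp
  then show ?thesis by (intro disjI1 tendsto_eventually)
next
  case False
  obtain K where K: "0 < K" "\<And>n. real (c n) \<le> K"
    using bdd by (auto simp: Bseq_def)
  have "(\<lambda>n. root n (real (c n))) \<longlonglongrightarrow> 1"
  proof (rule tendsto_sandwich)
    show "eventually (\<lambda>n. 1 \<le> root n (real (c n))) sequentially"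
    proof (rule eventually_sequentiallyI)
      fix n :: nat assume n: "1 \<le> n"
      with False have "1 \<le> c n" by (metis less_one not_le)
      with n show "1 \<le> root n (real (c n))" by simp
    qed
    show "eventually (\<lambda>n. root n (real (c n)) \<le> root n K) sequentially"
      by (rule eventually_sequentiallyI[of 1]) (use K in auto)
    show "(\<lambda>n. root n K) \<longlonglongrightarrow> 1" using K by (intro LIMSEQ_root_const)
  qed simp
  then show ?thesis ..
qed

section \<open>The two implications for a class\<close>

text \<open>Used to show that a class without the permutation of size \<open>1\<close> has nothing
  of positive size, and that a class with it also contains the empty permutation.\<close>

lemma pattern_of_size_le_1:
  assumes "is_perm p" "m \<le> 1" "m \<le> psize p"
  shows "is_perm (m, id)" "pattern_of (m, id) p"
proof -
  show "is_perm (m, id)" by (simp add: is_perm_def permutes_id)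
  show "pattern_of (m, id) p"
    unfolding pattern_of_def
  proof (intro exI[of _ id] conjI ballI)
    fix i j assume "i \<in> {1..psize (m, id)}" "j \<in> {1..psize (m, id)}"
    with assms(2) have "i = j" by simp
    then show "snd (m, id) i < snd (m, id) j \<longleftrightarrow> snd p (id i) < snd p (id j)" by simp
  qed (use assms in \<open>auto simp: strict_mono_on_def\<close>)
qed

theorem theorem4p5:
  fixes C :: "sized_perm set" and c :: "nat \<Rightarrow> nat"
  assumes "perm_class C" and "sum_closed C" and "rc_invariant C"
    and "\<And>n. c n = card {p \<in> of_size C n. sum_indecomposable p}"
  shows "(Bseq (\<lambda>n. real (c n)) \<longrightarrow>
            ((\<lambda>n. root n (real (c n))) \<longlonglongrightarrow> 0 \<or> (\<lambda>n. root n (real (c n))) \<longlonglongrightarrow> 1))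
       \<and> (((\<lambda>n. root n (real (c n))) \<longlonglongrightarrow> 0 \<or> (\<lambda>n. root n (real (c n))) \<longlonglongrightarrow> 1) \<longrightarrow>
            (\<exists>L. (\<lambda>n. root n (real (card {p \<in> of_size C (2 * n). centrosymmetric p}))) \<longlonglongrightarrow> L
               \<and> (\<lambda>n. root n (real (card (of_size C n)))) \<longlonglongrightarrow> L))"
proof (intro conjI impI)
  note C = assms(1)
  assume "Bseq (\<lambda>n. real (c n))"
  then show "(\<lambda>n. root n (real (c n))) \<longlonglongrightarrow> 0 \<or> (\<lambda>n. root n (real (c n))) \<longlonglongrightarrow> 1"
  proof (rule root_limit_0_or_1)
    fix m n assume mn: "1 \<le> m" "m \<le> n" "0 < c n"
    then obtain p where p: "p \<in> of_size C n" "sum_indecomposable p"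
      using assms(4)[of n] by (auto simp: card_gt_0_iff)
    then have "is_perm p" "psize p = n" "p \<in> C"
      by (auto simp: of_size_def dest: perm_class_is_perm[OF C])
    then obtain q where q: "is_perm q" "sum_indecomposable q" "psize q = m" "pattern_of q p"
      using indecomposable_pattern_of_size[of p m] p mn by auto
    then have "q \<in> {p \<in> of_size C m. sum_indecomposable p}"
      using perm_class_pattern[OF C \<open>p \<in> C\<close>] by (simp add: of_size_def)
    moreover have "finite {p \<in> of_size C m. sum_indecomposable p}"
      using finite_of_size[OF C] by simp
    ultimately show "0 < c m"
      unfolding assms(4) card_gt_0_iff by blast
  qed
next
  note C = assms(1)
  define a where "a n = real (card (of_size C n))" for n
  define b where "b n = real (card {p \<in> of_size C (2 * n). centrosymmetric p})" for n
  assume "(\<lambda>n. root n (real (c n))) \<longlonglongrightarrow> 0 \<or> (\<lambda>n. root n (real (c n))) \<longlonglongrightarrow> 1"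
  \<comment> \<open>Both admissible limits are at most \<open>1\<close>, so \<open>c\<close> is
    bounded by a multiple of \<open>y ^ n\<close> for every \<open>y > 1\<close>.\<close>
  then obtain l :: real where l: "l \<le> 1" "(\<lambda>n. root n (real (c n))) \<longlonglongrightarrow> l"
    by (metis order_refl zero_le_one)
  have cK: "\<exists>K>0. \<forall>n. real (c n) \<le> K * y ^ n" if "1 < y" for y
  proof -
    have "l < y" "1 \<le> y" using l(1) that by auto
    then obtain K where "0 < K" "\<And>n. real (c n) \<le> K * y ^ n"
      by (rule geometric_bound_of_root_limit[OF l(2)]) auto
    then show ?thesis by blast
  qed
  have small: "(m, id) \<in> of_size C m" if "p \<in> of_size C n" "m \<le> n" "m \<le> 1" for p m n
  proof -
    have "is_perm p" "p \<in> C" "psize p = n"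
      using that by (auto simp: of_size_def dest: perm_class_is_perm[OF C])
    then show ?thesis
      using pattern_of_size_le_1[of p m] that perm_class_pattern[OF C, of p "(m, id)"]
      by (simp add: of_size_def)
  qed
  have super: "a m * a n \<le> a (m + n)" for m n
    using card_of_size_supermult[OF assms(1,2), of m n] unfolding a_def
    by (metis of_nat_le_iff of_nat_mult)
  have "\<exists>L. (\<lambda>n. root n (b n)) \<longlonglongrightarrow> L \<and> (\<lambda>n. root n (a n)) \<longlonglongrightarrow> L"
  proof (cases "of_size C 1 = {}")
    \<comment> \<open>The class contains at most the empty permutation, and both limits are
      \<open>0\<close>.\<close>
    case True
    have empty: "of_size C n = {}" if "1 \<le> n" for n
      using small[of _ n 1] that True by blast
    have "root n (a n) = 0" "root n (b n) = 0" for n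
      using empty[of n] empty[of "2 * n"] by (cases "n = 0"; simp add: a_def b_def)+
    then show ?thesis by (intro exI[of _ 0]) simp
  next
    case False
    have a1: "1 \<le> a 1"
      using False finite_of_size[OF C, of 1] by (simp add: a_def card_gt_0_iff Suc_le_eq)
    have "of_size C 0 \<noteq> {}" using small[of _ 1 0] False by auto
    then have a0: "1 \<le> a 0"
      using finite_of_size[OF C, of 0] by (simp add: a_def card_gt_0_iff Suc_le_eq)
    have ge1: "1 \<le> a n" for n
    proof (induction n)
      case (Suc n)
      have "1 * 1 \<le> a n * a 1" using Suc a1 by (intro mult_mono) auto
      with super[of n 1] show ?case by simp
    qed (rule a0)
    \<comment> \<open>The base \<open>2\<close> is one choice above \<open>1\<close>, matching
      \<open>convolution_geometric_bound\<close>.\<close>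
    obtain K where K: "0 < K" "\<And>n. real (c n) \<le> K * 2 ^ n" using cK[of 2] by auto
    have "a n \<le> (2 * (K + 1)) ^ n" for n
    proof (rule convolution_geometric_bound)
      \<comment> \<open>Supermultiplicativity gives \<open>a 0 * a 0 \<le> a 0\<close>, and
        \<open>a 0\<close> is positive.\<close>
      show "a 0 \<le> 1" using super[of 0 0] a0 by (simp add: mult_le_cancel_left1)
      show "real (c k) \<le> K * 2 ^ k" for k by (rule K)
      fix n :: nat assume "0 < n"
      then show "a n \<le> (\<Sum>k\<in>{1..n}. real (c k) * a (n - k))"
        using card_of_size_le_convolution[OF C, of n] unfolding a_def assms(4)
        by (simp flip: of_nat_mult of_nat_sum)
    qed (use K ge1 in \<open>auto simp: a_def\<close>)
    then obtain L where L: "1 \<le> L" "\<And>n. a n \<le> L ^ n" "(\<lambda>n. root n (a n)) \<longlonglongrightarrow> L"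
      using supermultiplicative_root_limit[of a, OF ge1 super] by blast
    have "(\<lambda>n. root n (b n)) \<longlonglongrightarrow> L"
    proof (rule root_limit_squeeze[OF L(3,1) _ L(2)])
      show "a n \<le> b n" for n
        using card_of_size_le_centrosymmetric[OF assms(1-3)] by (simp add: a_def b_def)
      show "b n \<le> (\<Sum>k\<le>n. a k * real (c (2 * (n - k))))" for n
        using card_centrosymmetric_le_convolution[OF C, of n] unfolding a_def b_def assms(4)
        by (simp flip: of_nat_mult of_nat_sum)
    qed (use cK in \<open>auto simp: a_def\<close>)
    with L show ?thesis by blast
  qed
  then show "\<exists>L. (\<lambda>n. root n (real (card {p \<in> of_size C (2 * n). centrosymmetric p}))) \<longlonglongrightarrow> L
               \<and> (\<lambda>n. root n (real (card (of_size C n)))) \<longlonglongrightarrow> L"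
    by (simp add: a_def b_def)
qed

end
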